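(* Let $f(x)$ be a real polynomial that is symmetric with center of symmetry $d/2$, i.e. $\deg f\le d$ and $x^df(1/x)=f(x)$, and write $f(x)=\sum_{i=0}^{\lfloor d/2\rfloor}\gamma_ix^i(1+x)^{d-2i}$ and $\gamma_f(x)=\sum_{i=0}^{\lfloor d/2\rfloor}\gamma_ix^i$. If $\gamma_f\in\mathrm{ULC}(\lfloor d/2\rfloor)$, then $f\in\mathrm{ULC}(d)$.
   Context: For an integer $m$, $\mathrm{ULC}(m)$ denotes the set of polynomials $a(x)=\sum_{j=0}^{e}a_jx^j$ with nonnegative coefficients, $e\le m$, such that the sequence $\big(a_j/\binom{m}{j}\big)_{j=0}^{e}$ is log-concave and $a$ has no internal zeros (no indices $i<j<k$ with $a_j=0$ and $a_ia_k\ne0$). The representation of a symmetric polynomial in the basis $\{x^i(1+x)^{d-2i}\}$ is unique. *)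

theory Defs
  imports "HOL-Computational_Algebra.Polynomial"
begin

definition symmetric_poly :: "nat \<Rightarrow> real poly \<Rightarrow> bool" where
  "symmetric_poly d f \<longleftrightarrow>
     degree f \<le> d \<and> (\<forall>x::real. x \<noteq> 0 \<longrightarrow> x ^ d * poly f (1 / x) = poly f x)"

definition log_concave_upto :: "nat \<Rightarrow> (nat \<Rightarrow> real) \<Rightarrow> bool" where
  "log_concave_upto e b \<longleftrightarrow> (\<forall>j. 0 < j \<and> j < e \<longrightarrow> b (j - 1) * b (j + 1) \<le> (b j)\<^sup>2)"

definition no_internal_zeros :: "real poly \<Rightarrow> bool" where
  "no_internal_zeros a \<longleftrightarrow>
     \<not> (\<exists>i j k. i < j \<and> j < k \<and> coeff a j = 0 \<and> coeff a i * coeff a k \<noteq> 0)"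

text \<open>
  The zero polynomial has degree 0 and hence lies in every \<open>ULC m\<close>.
\<close>

definition ULC :: "nat \<Rightarrow> real poly set" where
  "ULC m = {a. (\<forall>j. 0 \<le> coeff a j) \<and> degree a \<le> m \<and>
               log_concave_upto (degree a) (\<lambda>j. coeff a j / real (m choose j)) \<and>
               no_internal_zeros a}"

definition gamma_expansion :: "nat \<Rightarrow> (nat \<Rightarrow> real) \<Rightarrow> real poly" where
  "gamma_expansion d \<gamma> = (\<Sum>i\<le>d div 2. smult (\<gamma> i) ([:0, 1:] ^ i * [:1, 1:] ^ (d - 2 * i)))"

definition gamma_poly :: "nat \<Rightarrow> (nat \<Rightarrow> real) \<Rightarrow> real poly" where
  "gamma_poly d \<gamma> = (\<Sum>i\<le>d div 2. smult (\<gamma> i) ([:0, 1:] ^ i))"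

text \<open>
  Every symmetric polynomial has a gamma expansion, and its coefficients up to \<open>d div 2\<close>
  are determined by the polynomial.
\<close>

lemma symmetric_poly_coeff:
  assumes "symmetric_poly d f" "i \<le> d"
  shows "coeff f (d - i) = coeff f i"
proof -
  define g where "g = (\<Sum>j\<le>d. monom (coeff f j) (d - j))"
  have deg: "degree f \<le> d" using assms by (simp add: symmetric_poly_def)
  have eq: "poly g x = poly f x" if "x \<noteq> 0" for x
  proof -
    have "poly f (1 / x) = (\<Sum>j\<le>d. coeff f j * (1 / x) ^ j)"
      unfolding poly_altdef using deg
      by (intro sum.mono_neutral_left) (auto simp: coeff_eq_0)
    then have "x ^ d * poly f (1 / x) = (\<Sum>j\<le>d. coeff f j * (x ^ d * (1 / x) ^ j))"
      by (simp add: sum_distrib_left mult.left_commute)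
    also have "\<dots> = poly g x"
      using that by (auto simp: g_def poly_sum poly_monom power_diff field_simps intro!: sum.cong)
    finally show ?thesis using assms that by (simp add: symmetric_poly_def)
  qed
  have "g = f"
  proof (rule ccontr)
    assume "g \<noteq> f"
    then have "finite {x. poly (g - f) x = 0}" by (intro poly_roots_finite) simp
    moreover have "{0::real<..} \<subseteq> {x. poly (g - f) x = 0}" using eq by auto
    ultimately show False using infinite_Ioi finite_subset by blast
  qed
  have "coeff g (d - i) = (\<Sum>j\<le>d. if j = i then coeff f j else 0)"
    unfolding g_def coeff_sum using assms(2) by (intro sum.cong) (auto simp: coeff_monom)
  also have "\<dots> = coeff f i" using assms(2) by simp
  finally show ?thesis using \<open>g = f\<close> by simp
qed

lemma gamma_expansion_rec:
  "gamma_expansion (Suc (Suc d)) \<gamma> =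
     smult (\<gamma> 0) ([:1, 1:] ^ Suc (Suc d)) + [:0, 1:] * gamma_expansion d (\<lambda>i. \<gamma> (Suc i))"
  by (simp add: gamma_expansion_def sum.atMost_Suc_shift sum_distrib_left mult.assoc
      del: sum.atMost_Suc power_Suc mult_pCons_left mult_pCons_right)
     (simp add: mult.assoc del: mult_pCons_left mult_pCons_right)

lemma symmetric_poly_one_plus_x: "symmetric_poly d (smult c ([:1, 1:] ^ d))"
proof -
  have "x ^ d * (1 + 1 / x) ^ d = (1 + x) ^ d" if "x \<noteq> 0" for x :: real
    using that by (simp add: power_mult_distrib [symmetric] distrib_left add.commute)
  moreover have "degree ([:1, 1::real:] ^ d) \<le> d"
    using degree_power_le [of "[:1, 1::real:]" d] by simp
  ultimately show ?thesis
    by (auto simp: symmetric_poly_def mult.left_commute intro: order_trans [OF degree_smult_le])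
qed

lemma symmetric_poly_diff:
  "symmetric_poly d f \<Longrightarrow> symmetric_poly d g \<Longrightarrow> symmetric_poly d (f - g)"
  by (auto simp: symmetric_poly_def right_diff_distrib intro: degree_diff_le)

lemma ex_gamma_expansion:
  assumes "symmetric_poly d f"
  shows "\<exists>\<gamma>. f = gamma_expansion d \<gamma>"
  using assms
proof (induction d arbitrary: f rule: induct_nat_012)
  case 0
  then show ?case
    by (auto simp: symmetric_poly_def gamma_expansion_def elim!: degree_eq_zeroE)
next
  case 1
  have "coeff f 1 = coeff f 0" using symmetric_poly_coeff [OF 1, of 0] by simp
  moreover have "degree f \<le> 1" using 1 by (simp add: symmetric_poly_def)
  ultimately have "f = [:coeff f 0, coeff f 0:]"
    by (intro poly_eqI) (auto simp: coeff_pCons coeff_eq_0 split: nat.splits)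
  then show ?case
    by (intro exI [of _ "\<lambda>_. coeff f 0"]) (simp add: gamma_expansion_def)
next
  case (ge2 d)
  define h where "h = f - smult (coeff f 0) ([:1, 1:] ^ Suc (Suc d))"
  have h: "symmetric_poly (Suc (Suc d)) h"
    unfolding h_def using ge2.prems symmetric_poly_one_plus_x by (rule symmetric_poly_diff)
  have "coeff h 0 = 0"
    by (simp add: h_def poly_0_coeff_0 [symmetric])
  then obtain g where g: "h = [:0, 1:] * g"
    by (cases h) auto
  have "coeff h (Suc (Suc d)) = 0"
    using symmetric_poly_coeff [OF h, of 0] \<open>coeff h 0 = 0\<close> by simp
  moreover have "coeff h i = 0" if "i > Suc (Suc d)" for i
    using h that by (intro coeff_eq_0) (simp add: symmetric_poly_def)
  ultimately have "coeff h (Suc i) = 0" if "i > d" for i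
    using that by (cases "i = Suc d") auto
  then have deg: "degree g \<le> d"
    by (intro degree_le) (simp add: g)
  have "x ^ d * poly g (1 / x) = poly g x" if "x \<noteq> 0" for x
    using h that by (auto simp: symmetric_poly_def g)
  with deg have "symmetric_poly d g" by (simp add: symmetric_poly_def)
  from ge2.IH(1) [OF this] obtain \<gamma> where "g = gamma_expansion d \<gamma>" ..
  then have "f = gamma_expansion (Suc (Suc d)) (case_nat (coeff f 0) \<gamma>)"
    using g by (simp add: gamma_expansion_rec h_def algebra_simps del: mult_pCons_left)
  then show ?case by blast
qed

lemma gamma_expansion_unique:
  assumes "gamma_expansion d \<gamma> = gamma_expansion d \<delta>" "i \<le> d div 2"
  shows "\<gamma> i = \<delta> i"
  using assms
proof (induction d arbitrary: \<gamma> \<delta> i rule: induct_nat_012)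
  case (ge2 d)
  have "poly (gamma_expansion (Suc (Suc d)) \<gamma>) 0 = poly (gamma_expansion (Suc (Suc d)) \<delta>) 0"
    using ge2.prems by simp
  then have 0: "\<gamma> 0 = \<delta> 0" by (simp add: gamma_expansion_rec)
  then have "gamma_expansion d (\<lambda>i. \<gamma> (Suc i)) = gamma_expansion d (\<lambda>i. \<delta> (Suc i))"
    using ge2.prems(1) by (simp add: gamma_expansion_rec)
  then show ?case
    using ge2.IH(1) ge2.prems(2) 0 by (cases i) auto
qed (auto simp: gamma_expansion_def)

end

theory Submission
  imports Defs
begin

text \<open>
  Dividing the coefficients of \<open>f\<close> by binomial coefficients gives
  \<open>F j = (\<Sum>i. e i * a j i)\<close>, where \<open>e\<close> is again log-concave and
  \<open>a j i = falling j i * falling (d - j) i / (i! * (d - 1) * (d - 3) * \<dots> * (d - 2 * i + 1))\<close>.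
  Since \<open>F\<close> is symmetric, and increasing up to \<open>d / 2\<close>, only \<open>j + 1 \<le> d div 2\<close> needs work.

  In \<open>(F j)\<^sup>2 - F (j - 1) * F (j + 1)\<close> collect, for each \<open>n\<close>, the terms \<open>T i k * e i * e k\<close>
  with \<open>i + k = n\<close>. The sign of \<open>T i k\<close> is that of a concave quadratic in
  \<open>(j + 1 - i) * (j + 1 - k)\<close> which is nonnegative at \<open>i = k\<close>; so \<open>T\<close> changes sign at most once, from
  negative to positive, as \<open>i\<close> and \<open>k\<close> approach each other, while \<open>e i * e k\<close> increases. Hence it
  suffices that \<open>T i k\<close> sums to a nonnegative number for each \<open>n\<close>, i.e. that the polynomials
  \<open>A j = (\<Sum>i. a j i * r ^ i)\<close> make \<open>W j = (A j)\<^sup>2 - A (j - 1) * A (j + 1)\<close> have nonnegative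
  coefficients.

  The \<open>A j\<close> are Gegenbauer polynomials of parameter \<open>- d / 2\<close>, with \<open>t = d - 2 * j\<close> satisfying
  \<open>(d - j) * A (j + 1) = t * (1 + r) * A j + j * A (j - 1)\<close>. This yields
  \<open>(t + 2) * (d - j) * W j + t * (j - 1) * W (j - 1) = d * ((A j)\<^sup>2 - (A (j - 1))\<^sup>2)\<close>, and the right hand
  side does not drop too fast as \<open>j\<close> grows, so that positivity follows by induction.
\<close>

section \<open>Falling factorials and identities for products of two of them\<close>

definition falling :: "real \<Rightarrow> nat \<Rightarrow> real" where
  "falling x n = (\<Prod>l<n. x - real l)"

lemma falling_0 [simp]: "falling x 0 = 1"
  by (simp add: falling_def)

lemma falling_Suc: "falling x (Suc n) = falling x n * (x - real n)"
  by (simp add: falling_def)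

lemma falling_Suc_shift: "falling x (Suc n) = x * falling (x - 1) n"
  unfolding falling_def by (subst prod.lessThan_Suc_shift) (simp add: algebra_simps)

lemma falling_of_nat_eq_0: "k < n \<Longrightarrow> falling (real k) n = 0"
  by (auto simp: falling_def)

lemma falling_of_nat_pos: "n \<le> k \<Longrightarrow> falling (real k) n > 0"
  unfolding falling_def by (rule prod_pos) auto

lemma falling_of_nat_nonneg: "falling (real k) n \<ge> 0"
  using falling_of_nat_eq_0 [of k n] falling_of_nat_pos [of n k] by (cases "k < n") auto

lemma falling_of_nat_fact: "n \<le> k \<Longrightarrow> falling (real k) n = fact k / fact (k - n)"
proof (induction n)
  case (Suc n)
  then have "k - n = Suc (k - Suc n)" by simp
  then have "fact (k - n) = real (k - n) * fact (k - Suc n)"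
    by (metis fact_Suc of_nat_fact of_nat_mult)
  with Suc show ?case by (simp add: falling_Suc of_nat_diff)
qed simp

text \<open>Both products contain \<open>falling (p - 1) n * falling q n\<close>; the cofactors
  \<open>p * (q - n)\<close> and \<open>(p - 1 - n) * (q + 1)\<close> are subtracted. This yields
  the increments of \<open>newton_coeff\<close> in \<open>j\<close>.\<close>

lemma falling_mult_shift_diff:
  "falling p (Suc n) * falling q (Suc n) - falling (p - 1) (Suc n) * falling (q + 1) (Suc n)
     = (real n + 1) * (q - p + 1) * (falling (p - 1) n * falling q n)"
proof -
  have 1: "falling p (Suc n) = p * falling (p - 1) n" by (rule falling_Suc_shift)
  have 2: "falling (q + 1) (Suc n) = (q + 1) * falling q n" using falling_Suc_shift [of "q + 1"] by simp
  show ?thesis unfolding 1 2 falling_Suc [of q] falling_Suc [of "p - 1"] by (simp add: algebra_simps)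
qed

text \<open>For \<open>p = j\<close> and \<open>q = d - j\<close> this is the recurrence of the
  \<open>A j\<close>, coefficient by coefficient. The multipliers \<open>q\<close> and
  \<open>p\<close> make every term a multiple of \<open>falling p n * falling q n\<close>, which
  leaves a polynomial identity.\<close>

lemma falling_mult_three_term:
  "q * (falling (p + 1) (Suc n) * falling (q - 1) (Suc n))
     = (q - p) * (falling p (Suc n) * falling q (Suc n)) + p * (falling (p - 1) (Suc n) * falling (q + 1) (Suc n))
       + (real n + 1) * (p + q - 1 - 2 * real n) * (q - p) * (falling p n * falling q n)"
proof -
  have 1: "falling (p + 1) (Suc n) = (p + 1) * falling p n" using falling_Suc_shift [of "p + 1"] by simp
  have 2: "falling (q + 1) (Suc n) = (q + 1) * falling q n" using falling_Suc_shift [of "q + 1"] by simp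
  have 3: "q * falling (q - 1) (Suc n) = falling q n * (q - real n) * (q - real n - 1)"
    using falling_Suc_shift [of q "Suc n"] by (simp add: falling_Suc algebra_simps)
  have 4: "p * falling (p - 1) (Suc n) = falling p n * (p - real n) * (p - real n - 1)"
    using falling_Suc_shift [of p "Suc n"] by (simp add: falling_Suc algebra_simps)
  have "q * (falling (p + 1) (Suc n) * falling (q - 1) (Suc n)) = falling (p + 1) (Suc n) * (q * falling (q - 1) (Suc n))"
    by simp
  also have "\<dots> = (q - p) * (falling p (Suc n) * falling q (Suc n))
      + (p * falling (p - 1) (Suc n)) * falling (q + 1) (Suc n)
       + (real n + 1) * (p + q - 1 - 2 * real n) * (q - p) * (falling p n * falling q n)"
    unfolding 1 2 3 4 falling_Suc [of p] falling_Suc [of q] by algebra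
  finally show ?thesis by (simp add: mult.assoc)
qed

text \<open>The difference of the two sides is \<open>falling_mult_shift_diff\<close> at
  \<open>p + 1\<close> and \<open>q\<close>, where the linear factor becomes
  \<open>q - p\<close>.\<close>

lemma falling_mult_mono:
  assumes "p \<le> q"
  shows "falling (real p) n * falling (real q + 1) n \<le> falling (real p + 1) n * falling (real q) n"
proof (cases n)
  case (Suc k)
  have "0 \<le> (real k + 1) * (real q - (real p + 1) + 1) * (falling (real p + 1 - 1) k * falling (real q) k)"
    using assms by (intro mult_nonneg_nonneg) (auto simp: falling_of_nat_nonneg)
  then show ?thesis using falling_mult_shift_diff [of "real p + 1" k "real q"] Suc by simp
qed simp

section \<open>Weighted Newton basis values and their growth in \<open>j\<close>\<close>

definition newton_weight :: "nat \<Rightarrow> nat \<Rightarrow> real" where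
  "newton_weight d i = fact i * (\<Prod>l<i. real d - 1 - 2 * real l)"

lemma newton_weight_pos: "2 * i \<le> d \<Longrightarrow> newton_weight d i > 0"
  unfolding newton_weight_def by (intro mult_pos_pos prod_pos) auto

lemma newton_weight_Suc: "newton_weight d (Suc i) = newton_weight d i * ((real i + 1) * (real d - 1 - 2 * real i))"
  by (simp add: newton_weight_def algebra_simps)

text \<open>
  As \<open>(j - l) * (d - j - l) = j * (d - j) - l * (d - l)\<close>, these are values at the node \<open>j * (d - j)\<close> of
  the Newton basis polynomials with nodes \<open>l * (d - l)\<close>; the weight is \<open>i!\<close> times the product of
  the gaps between consecutive nodes.
\<close>

definition newton_coeff :: "nat \<Rightarrow> nat \<Rightarrow> nat \<Rightarrow> real" where
  "newton_coeff d j i = falling (real j) i * falling (real d - real j) i / newton_weight d i"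

lemma newton_coeff_0 [simp]: "newton_coeff d j 0 = 1"
  by (simp add: newton_coeff_def newton_weight_def)

lemma newton_coeff_eq_0: "j < i \<Longrightarrow> newton_coeff d j i = 0"
  by (simp add: newton_coeff_def falling_of_nat_eq_0)

lemma newton_coeff_nonneg:
  assumes "2 * j \<le> d"
  shows "newton_coeff d j i \<ge> 0"
proof (cases "i \<le> j")
  case True
  have eq: "real d - real j = real (d - j)" using assms by simp
  show ?thesis unfolding newton_coeff_def eq using assms True
    by (intro divide_nonneg_nonneg mult_nonneg_nonneg falling_of_nat_nonneg less_imp_le [OF newton_weight_pos]) auto
qed (simp add: newton_coeff_eq_0)

lemma newton_coeff_step:
  "newton_coeff d (Suc j) (Suc i) - newton_coeff d j (Suc i)
    = (real i + 1) * (real d - 2 * real j - 1) * (falling (real j) i * falling (real d - real j - 1) i) / newton_weight d (Suc i)"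
  using falling_mult_shift_diff [of "real j + 1" i "real d - real j - 1"]
  by (simp add: newton_coeff_def diff_divide_distrib [symmetric] algebra_simps)

lemma newton_coeff_mono:
  assumes "2 * Suc j \<le> d"
  shows "newton_coeff d j i \<le> newton_coeff d (Suc j) i"
proof (cases i)
  case (Suc k)
  show ?thesis
  proof (cases "Suc k \<le> Suc j")
    case True
    have eq: "real d - real j - 1 = real (d - j - 1)" using assms by simp
    have "0 \<le> (real k + 1) * (real d - 2 * real j - 1) * (falling (real j) k * falling (real d - real j - 1) k) / newton_weight d (Suc k)"
      unfolding eq using assms True
      by (intro divide_nonneg_nonneg mult_nonneg_nonneg falling_of_nat_nonneg less_imp_le [OF newton_weight_pos]) auto
    then show ?thesis using newton_coeff_step [of d j k] Suc by simp
  next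
    case False then show ?thesis using Suc by (simp add: newton_coeff_eq_0)
  qed
qed simp

lemma newton_coeff_mono_le:
  assumes "2 * k \<le> d" "j \<le> k"
  shows "newton_coeff d j i \<le> newton_coeff d k i"
  using assms(2,1)
proof (induction k rule: dec_induct)
  case (step k)
  then show ?case using newton_coeff_mono [of k d i] by simp
qed simp

text \<open>Each increment carries one of the two linear factors and its multiplier supplies the
  other, so both sides share the constant \<open>c\<close>; \<open>falling_mult_mono\<close>
  compares the rest.\<close>

lemma newton_coeff_step_ratio:
  assumes "2 * Suc (Suc j) \<le> d"
  shows "(real d - 2 * real j - 3) * (newton_coeff d (Suc j) i - newton_coeff d j i)
     \<le> (real d - 2 * real j - 1) * (newton_coeff d (Suc (Suc j)) i - newton_coeff d (Suc j) i)"
proof (cases i)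
  case (Suc k)
  show ?thesis
  proof (cases "Suc k \<le> Suc (Suc j)")
    case True
    define c where "c = (real k + 1) * (real d - 2 * real j - 1) * (real d - 2 * real j - 3) / newton_weight d (Suc k)"
    have "newton_weight d (Suc k) > 0" using assms True by (intro newton_weight_pos) simp
    then have c: "c \<ge> 0" unfolding c_def using assms
      by (intro divide_nonneg_nonneg mult_nonneg_nonneg) auto
    have "real (d - j - 2) = real d - real j - 2" using assms by simp
    then have "falling (real j) k * falling (real d - real j - 1) k \<le> falling (real j + 1) k * falling (real d - real j - 2) k"
      using falling_mult_mono [of j "d - j - 2" k] assms by (simp add: add.commute)
    from mult_left_mono [OF this c]
    have "c * (falling (real j) k * falling (real d - real j - 1) k) \<le> c * (falling (real j + 1) k * falling (real d - real j - 2) k)" .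
    moreover have "(real d - 2 * real j - 3) * (newton_coeff d (Suc j) i - newton_coeff d j i) = c * (falling (real j) k * falling (real d - real j - 1) k)"
      using newton_coeff_step [of d j k] assms Suc by (simp add: c_def mult_ac)
    moreover have "(real d - 2 * real j - 1) * (newton_coeff d (Suc (Suc j)) i - newton_coeff d (Suc j) i)
        = c * (falling (real j + 1) k * falling (real d - real j - 2) k)"
      using newton_coeff_step [of d "Suc j" k] assms Suc by (simp add: c_def mult_ac algebra_simps)
    ultimately show ?thesis by simp
  next
    case False then show ?thesis using Suc by (simp add: newton_coeff_eq_0)
  qed
qed simp

section \<open>The polynomials \<open>A j\<close> and their three-term recurrence\<close>

definition newton_poly :: "nat \<Rightarrow> nat \<Rightarrow> real poly" where
  "newton_poly d j = (\<Sum>i\<le>j. monom (newton_coeff d j i) i)"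

lemma coeff_newton_poly [simp]: "coeff (newton_poly d j) i = newton_coeff d j i"
  by (simp add: newton_poly_def coeff_sum newton_coeff_eq_0 not_le)

text \<open>Coefficientwise this is \<open>falling_mult_three_term\<close>;
  \<open>newton_weight_Suc\<close> turns its last term into the contribution of the \<open>x\<close>
  in \<open>[:1, 1:]\<close>.\<close>

lemma newton_poly_three_term:
  assumes "d = 2 * j + t" "t \<ge> 2"
  shows "of_nat (j + t) * newton_poly d (Suc j) = of_nat t * [:1, 1:] * newton_poly d j + of_nat j * newton_poly d (j - 1)"
proof (rule poly_eqI)
  fix i
  show "coeff (of_nat (j + t) * newton_poly d (Suc j)) i
      = coeff (of_nat t * [:1, 1:] * newton_poly d j + of_nat j * newton_poly d (j - 1)) i"
  proof (cases i)
    case 0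
    then show ?thesis by (simp add: of_nat_poly algebra_simps)
  next
    case (Suc n)
    have d: "real d = 2 * real j + real t" using assms by simp
    have eq: "(real j + real t) * newton_coeff d (Suc j) (Suc n)
      = real t * newton_coeff d j (Suc n) + real t * newton_coeff d j n + real j * newton_coeff d (j - 1) (Suc n)"
    proof (cases "n \<le> j")
      case True
      \<comment> \<open>\<open>n \<le> j\<close> and \<open>t \<ge> 2\<close> give
        \<open>2 * Suc n \<le> d\<close>, so no weight vanishes.\<close>
      have w: "newton_weight d n > 0" "newton_weight d (Suc n) > 0" using True assms by (auto intro!: newton_weight_pos)
      have ne: "(real n + 1) * (real d - 1 - 2 * real n) \<noteq> 0" using True assms by auto
      have n: "newton_coeff d j n = (real n + 1) * (real d - 1 - 2 * real n) * (falling (real j) n * falling (real d - real j) n) / newton_weight d (Suc n)"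
        unfolding newton_weight_Suc newton_coeff_def using w ne by simp
      \<comment> \<open>At \<open>j = 0\<close> the truncated \<open>j - 1\<close> differs from
        \<open>real j - 1\<close>, but the factor \<open>j\<close> makes both sides zero.\<close>
      have m: "real j * newton_coeff d (j - 1) (Suc n) = real j * (falling (real j - 1) (Suc n) * falling (real d - real j + 1) (Suc n)) / newton_weight d (Suc n)"
        by (cases j) (simp_all add: newton_coeff_def algebra_simps)
      have key: "(real j + real t) * (falling (real j + 1) (Suc n) * falling (real d - real j - 1) (Suc n))
        = real t * (falling (real j) (Suc n) * falling (real d - real j) (Suc n))
          + real j * (falling (real j - 1) (Suc n) * falling (real d - real j + 1) (Suc n))
          + (real n + 1) * (real d - 1 - 2 * real n) * real t * (falling (real j) n * falling (real d - real j) n)"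
        using falling_mult_three_term [of "real d - real j" "real j" n] unfolding d by (simp add: algebra_simps)
      have "(real j + real t) * newton_coeff d (Suc j) (Suc n)
        = ((real j + real t) * (falling (real j + 1) (Suc n) * falling (real d - real j - 1) (Suc n))) / newton_weight d (Suc n)"
        by (simp add: newton_coeff_def algebra_simps)
      also have "\<dots> = (real t * (falling (real j) (Suc n) * falling (real d - real j) (Suc n))
          + real j * (falling (real j - 1) (Suc n) * falling (real d - real j + 1) (Suc n))
          + (real n + 1) * (real d - 1 - 2 * real n) * real t * (falling (real j) n * falling (real d - real j) n)) / newton_weight d (Suc n)"
        by (simp only: key)
      also have "\<dots> = real t * newton_coeff d j (Suc n) + real t * newton_coeff d j n + real j * newton_coeff d (j - 1) (Suc n)"
        unfolding m n by (simp add: newton_coeff_def [of _ _ "Suc n"] add_divide_distrib mult_ac)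
      finally show ?thesis .
    next
      case False
      then show ?thesis by (simp add: newton_coeff_eq_0)
    qed
    then show ?thesis using Suc by (simp add: of_nat_poly algebra_simps)
  qed
qed

definition nonneg_coeffs :: "real poly \<Rightarrow> bool" where
  "nonneg_coeffs p \<longleftrightarrow> (\<forall>n. 0 \<le> coeff p n)"

lemma nonneg_coeffs_add: "nonneg_coeffs p \<Longrightarrow> nonneg_coeffs q \<Longrightarrow> nonneg_coeffs (p + q)"
  by (simp add: nonneg_coeffs_def)

lemma nonneg_coeffs_mult: "nonneg_coeffs p \<Longrightarrow> nonneg_coeffs q \<Longrightarrow> nonneg_coeffs (p * q)"
  by (auto simp: nonneg_coeffs_def coeff_mult intro!: sum_nonneg)

lemma nonneg_coeffs_newton_poly: "2 * j \<le> d \<Longrightarrow> nonneg_coeffs (newton_poly d j)"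
  by (simp add: nonneg_coeffs_def newton_coeff_nonneg)

lemma nonneg_coeffs_newton_poly_diff: "2 * Suc j \<le> d \<Longrightarrow> nonneg_coeffs (newton_poly d (Suc j) - newton_poly d j)"
  by (simp add: nonneg_coeffs_def newton_coeff_mono)

section \<open>Turan determinants and the nonnegativity of their coefficients\<close>

text \<open>The \<open>W j\<close> of the outline. Its value at \<open>j = 0\<close> depends on
  truncated subtraction; \<open>turan_rec\<close> multiplies that value by zero.\<close>

definition turan :: "nat \<Rightarrow> nat \<Rightarrow> real poly" where
  "turan d j = newton_poly d j * newton_poly d j - newton_poly d (j - 1) * newton_poly d (Suc j)"

definition sqdiff :: "nat \<Rightarrow> nat \<Rightarrow> real poly" where
  "sqdiff d j = newton_poly d (Suc j) * newton_poly d (Suc j) - newton_poly d j * newton_poly d j"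

lemma sqdiff_factor: "sqdiff d j = (newton_poly d (Suc j) + newton_poly d j) * (newton_poly d (Suc j) - newton_poly d j)"
  by (simp add: sqdiff_def algebra_simps)

lemma nonneg_coeffs_sqdiff: "2 * Suc j \<le> d \<Longrightarrow> nonneg_coeffs (sqdiff d j)"
  unfolding sqdiff_factor
  by (intro nonneg_coeffs_mult nonneg_coeffs_add nonneg_coeffs_newton_poly nonneg_coeffs_newton_poly_diff) auto

text \<open>With \<open>D\<close> and \<open>E\<close> the two consecutive increments, the
  difference is \<open>(A (j + 1) + A j) * (b * E - a * D) + (E + D) * (b * E)\<close>. All factors
  have nonnegative coefficients, \<open>b * E - a * D\<close> by
  \<open>newton_coeff_step_ratio\<close>.\<close>

lemma sqdiff_ratio:
  assumes "2 * Suc (Suc j) \<le> d"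
  shows "(real d - 2 * real j - 3) * coeff (sqdiff d j) n
    \<le> (real d - 2 * real j - 1) * coeff (sqdiff d (Suc j)) n"
proof -
  define a b where "a = real d - 2 * real j - 3" and "b = real d - 2 * real j - 1"
  define D E where "D = newton_poly d (Suc j) - newton_poly d j" and "E = newton_poly d (Suc (Suc j)) - newton_poly d (Suc j)"
  have b: "b \<ge> 0" using assms by (simp add: b_def)
  have nD: "nonneg_coeffs D" and nE: "nonneg_coeffs E"
    unfolding D_def E_def using assms by (auto intro!: nonneg_coeffs_newton_poly_diff)
  have 1: "nonneg_coeffs (smult b E - smult a D)"
    using newton_coeff_step_ratio [OF assms] by (simp add: nonneg_coeffs_def a_def b_def D_def E_def)
  have 2: "nonneg_coeffs (newton_poly d (Suc j) + newton_poly d j)"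
    using assms by (intro nonneg_coeffs_add nonneg_coeffs_newton_poly) auto
  have 3: "nonneg_coeffs (smult b E)" using nE b by (simp add: nonneg_coeffs_def)
  have "smult b (sqdiff d (Suc j)) - smult a (sqdiff d j)
     = (newton_poly d (Suc j) + newton_poly d j) * (smult b E - smult a D) + (E + D) * smult b E"
    unfolding sqdiff_factor D_def E_def
    by (simp add: algebra_simps smult_add_right smult_diff_right)
  also have "nonneg_coeffs \<dots>"
    by (intro nonneg_coeffs_add nonneg_coeffs_mult 1 2 3 nD nE)
  finally show ?thesis by (simp add: nonneg_coeffs_def a_def b_def)
qed

text \<open>This follows from the three-term recurrences at \<open>Suc j\<close> and
  \<open>j\<close>, whose gaps \<open>d - 2 * Suc j\<close> and \<open>d - 2 * j\<close> are
  \<open>t\<close> and \<open>t + 2\<close>.\<close>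

lemma turan_rec:
  assumes "d = 2 * Suc j + t" "t \<ge> 2"
  shows "real ((t + 2) * (Suc j + t)) * coeff (turan d (Suc j)) n + real (t * j) * coeff (turan d j) n
     = real d * coeff (sqdiff d j) n"
proof -
  let ?y = "[:1, 1:] :: real poly"
  \<comment> \<open>The factor \<open>[:1, 1:]\<close> is kept as an arbitrary \<open>y\<close>; it
    cancels between the two recurrences.\<close>
  have ring: "(t + 2) * (J + 1 + t) * (F2 * F2 - F1 * F3) + t * J * (F1 * F1 - F0 * F2)
      = (2 * (J + 1) + t) * (F2 * F2 - F1 * F1)"
    if "(J + 1 + t) * F3 = t * y * F2 + (J + 1) * F1" "(J + t + 2) * F2 = (t + 2) * y * F1 + J * F0"
    for J t y F0 F1 F2 F3 :: "real poly"
    using that by algebra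
  have 1: "(of_nat j + 1 + of_nat t) * newton_poly d (Suc (Suc j))
      = of_nat t * ?y * newton_poly d (Suc j) + (of_nat j + 1) * newton_poly d j"
    using newton_poly_three_term [of d "Suc j" t] assms by (simp add: add_ac)
  have 2: "(of_nat j + of_nat t + 2) * newton_poly d (Suc j)
      = (of_nat t + 2) * ?y * newton_poly d j + of_nat j * newton_poly d (j - 1)"
    using newton_poly_three_term [of d j "t + 2"] assms by (simp add: add_ac)
  have c: "of_nat ((t + 2) * (Suc j + t)) = (of_nat t + 2) * (of_nat j + 1 + of_nat t :: real poly)"
    "of_nat (t * j) = (of_nat t * of_nat j :: real poly)"
    "of_nat d = (2 * (of_nat j + 1) + of_nat t :: real poly)"
    using assms by (simp_all add: algebra_simps)
  have "of_nat ((t + 2) * (Suc j + t)) * turan d (Suc j) + of_nat (t * j) * turan d j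
     = of_nat d * sqdiff d j"
    unfolding c turan_def sqdiff_def using ring [OF 1 2] by simp
  from arg_cong [OF this, of "\<lambda>p. coeff p n"] show ?thesis
    by (simp add: of_nat_poly del: of_nat_mult of_nat_add of_nat_Suc)
qed

text \<open>In \<open>turan_rec\<close> the previous determinant stands on the same side, so it
  needs an upper bound. The same relation one index lower, with its last term dropped, bounds it by
  \<open>sqdiff d k\<close>, and \<open>sqdiff_ratio\<close> leads back to
  \<open>sqdiff d j\<close>.\<close>

lemma coeff_turan_nonneg:
  assumes "2 * Suc (Suc j) \<le> d"
  shows "0 \<le> coeff (turan d (Suc j)) n"
  using assms
proof (induction j rule: less_induct)
  case (less j)
  show ?case
  proof (cases j)
    case 0
    have "real (d * (d - 1)) * coeff (turan d (Suc 0)) n = real d * coeff (sqdiff d 0) n"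
      using turan_rec [of d 0 "d - 2" n] less.prems 0 by (simp add: Suc_diff_Suc numeral_2_eq_2 del: of_nat_mult)
    also have "\<dots> \<ge> 0" using nonneg_coeffs_sqdiff [of 0 d] less.prems by (simp add: nonneg_coeffs_def)
    finally have "0 \<le> real (d * (d - 1)) * coeff (turan d (Suc 0)) n" .
    moreover have "real (d * (d - 1)) > 0" using less.prems by simp
    ultimately show ?thesis unfolding 0 by (metis zero_le_mult_iff not_less)
  next
    case (Suc k)
    define t where "t = d - 2 * Suc j"
    have t: "d = 2 * Suc j + t" "t \<ge> 2" using less.prems by (auto simp: t_def)
    define w w' u u' where "w = coeff (turan d (Suc j)) n" and "w' = coeff (turan d j) n"
      and "u = coeff (sqdiff d j) n" and "u' = coeff (sqdiff d k) n"
    \<comment> \<open>Two indices down the induction hypothesis applies, except at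
      \<open>k = 0\<close>, where the factor \<open>k\<close> removes the term.\<close>
    have w'': "0 \<le> real ((t + 2) * k) * coeff (turan d k) n"
      using less.IH [of "k - 1"] Suc less.prems by (cases k) auto
    have 1: "real (t + 2) * real (Suc j + t) * w + real (t * j) * w' = real d * u"
      using turan_rec [OF t, of n] unfolding w_def w'_def u_def of_nat_mult by simp
    have 2: "real (t + 4) * real (j + t + 2) * w' \<le> real d * u'"
    proof -
      have "real (t + 4) * real (j + t + 2) * w' + real ((t + 2) * k) * coeff (turan d k) n = real d * u'"
        using turan_rec [of d k "t + 2" n] t Suc unfolding w'_def u'_def of_nat_mult
        by (simp add: add_ac)
      with w'' show ?thesis by linarith
    qed
    have w': "w' \<ge> 0" using less.IH [of k] Suc less.prems by (simp add: w'_def)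
    have u': "u' \<ge> 0"
      using nonneg_coeffs_sqdiff [of k d] Suc less.prems by (simp add: u'_def nonneg_coeffs_def)
    have 3: "(real t + 1) * u' \<le> (real t + 3) * u"
      using sqdiff_ratio [of k d n] Suc less.prems t by (simp add: u_def u'_def add_ac)
    have "real (t * j) * w' \<le> real t * (real (j + t + 2) * w')"
      using w' by (simp add: mult_left_mono mult_right_mono mult.assoc)
    then have "(real t + 4) * (real (t * j) * w') \<le> (real t + 4) * (real t * (real (j + t + 2) * w'))"
      by (intro mult_left_mono) auto
    also have "\<dots> = real t * (real (t + 4) * real (j + t + 2) * w')" by (simp add: mult_ac)
    also have "\<dots> \<le> real t * (real d * u')"
      using 2 by (intro mult_left_mono) auto
    finally have 4: "(real t + 4) * (real (t * j) * w') \<le> real d * (real t * u')" by (simp add: mult_ac)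
    \<comment> \<open>The margin that closes the induction:
      \<open>t * (t + 3) \<le> (t + 1) * (t + 4)\<close>.\<close>
    have "(real t + 3) * (real t * u') \<le> (real t + 4) * ((real t + 1) * u')"
      using u' by (simp add: algebra_simps)
    also have "\<dots> \<le> (real t + 4) * ((real t + 3) * u)"
      using 3 by (intro mult_left_mono) auto
    finally have "(real t + 3) * (real t * u') \<le> (real t + 3) * ((real t + 4) * u)"
      by (simp add: mult_ac)
    then have "real t * u' \<le> (real t + 4) * u" by (simp add: mult_le_cancel_left)
    then have "real d * (real t * u') \<le> real d * ((real t + 4) * u)" by (intro mult_left_mono) auto
    with 4 have "(real t + 4) * (real (t * j) * w') \<le> real d * ((real t + 4) * u)" by (rule order_trans)
    also have "\<dots> = (real t + 4) * (real d * u)" by simp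
    finally have "(real t + 4) * (real (t * j) * w') \<le> (real t + 4) * (real d * u)" .
    then have "real (t * j) * w' \<le> real d * u" by (simp add: mult_le_cancel_left)
    with 1 have "0 \<le> real (t + 2) * real (Suc j + t) * w" by linarith
    moreover have "real (t + 2) * real (Suc j + t) > 0" by simp
    ultimately show ?thesis unfolding w_def [symmetric] by (metis zero_le_mult_iff not_less)
  qed
qed


section \<open>The sign of the symmetrised determinant terms\<close>

lemma quadratic_between_nonneg:
  fixes a b c x y z :: real
  assumes "a \<le> 0" "x \<le> y" "y \<le> z" "a * x\<^sup>2 + b * x + c \<ge> 0" "a * z\<^sup>2 + b * z + c \<ge> 0"
  shows "a * y\<^sup>2 + b * y + c \<ge> 0"
proof (cases "x = z")
  case True then show ?thesis using assms by simp
next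
  case False
  then have pos: "z - x > 0" using assms by simp
  \<comment> \<open>Chord through the end values plus a remainder with the sign of
    \<open>- a\<close>.\<close>
  have "(z - x) * (a * y\<^sup>2 + b * y + c)
     = (a * x\<^sup>2 + b * x + c) * (z - y) + (a * z\<^sup>2 + b * z + c) * (y - x) + (- a) * ((y - x) * (z - y) * (z - x))"
    by (simp add: algebra_simps power2_eq_square)
  also have "\<dots> \<ge> 0"
    by (rule add_nonneg_nonneg [OF add_nonneg_nonneg])
      (rule mult_nonneg_nonneg; use assms in simp)+
  finally show ?thesis using pos by (simp add: zero_le_mult_iff)
qed

text \<open>The factor that decides the sign of \<open>turan_sym\<close>, with \<open>J = j\<close>,
  \<open>t = d - 2 * j\<close>, \<open>p = j + 1 - i\<close> and \<open>r = j + 1 - k\<close>. The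
  arguments are real because the midpoint of \<open>p\<close> and \<open>r\<close> is needed
  too.\<close>

definition crossing_form :: "real \<Rightarrow> real \<Rightarrow> real \<Rightarrow> real \<Rightarrow> real" where
  "crossing_form J t p r = 2 * J * (J + t) * (p * (p + t) * (r * (r + t)))
     - (J + 1) * (J + t + 1) * (p * (p - 1) * ((r + t) * (r + t - 1)) + r * (r - 1) * ((p + t) * (p + t - 1)))"

text \<open>For fixed \<open>p + r\<close>, both symmetric parts are polynomials in
  \<open>p * r\<close>. As \<open>b\<close> and \<open>c\<close> depend only on \<open>J\<close>,
  \<open>t\<close> and \<open>S\<close>, one quadratic serves all pairs with the same sum.\<close>

lemma crossing_form_quadratic:
  fixes J t S :: real
  defines "a \<equiv> - 2 * (2 * J + t + 1)"
  obtains b c where "\<And>p r. p + r = S \<Longrightarrow> crossing_form J t p r = a * (p * r)\<^sup>2 + b * (p * r) + c"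
proof
  fix p r assume "p + r = S"
  then have S: "S = p + r" by simp
  show "crossing_form J t p r = a * (p * r)\<^sup>2
    + (2 * J * (J + t) * (t * S + t\<^sup>2)
       - (J + 1) * (J + t + 1) * (2 * t * S - 2 * t\<^sup>2 + 2 - 2 * S - 2 * t)) * (p * r)
    + - ((J + 1) * (J + t + 1)) * (t * (t - 1) * (S * (S - 1)))"
  proof -
    have 1: "p * (p + t) * (r * (r + t)) = (p * r)\<^sup>2 + (t * S + t\<^sup>2) * (p * r)"
      unfolding S by (simp add: algebra_simps power2_eq_square)
    have 2: "p * (p - 1) * ((r + t) * (r + t - 1)) + r * (r - 1) * ((p + t) * (p + t - 1))
       = 2 * (p * r)\<^sup>2 + (2 * t * S - 2 * t\<^sup>2 + 2 - 2 * S - 2 * t) * (p * r) + t * (t - 1) * (S * (S - 1))"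
      unfolding S by (simp add: algebra_simps power2_eq_square)
    have 3: "a = 2 * J * (J + t) - 2 * ((J + 1) * (J + t + 1))"
      unfolding a_def by (simp add: algebra_simps)
    have 4: "K * (X + y * Z) - M * (2 * X + B * Z + C) = (K - 2 * M) * X + (K * y - M * B) * Z + - M * C"
      for K M B C X Z y :: real
      by (simp add: algebra_simps)
    show ?thesis unfolding crossing_form_def 1 2 3 by (rule 4)
  qed
qed

text \<open>With \<open>q = p + t\<close> the form is \<open>2 * p * q\<close> times \<open>J * (J +
  t) * p * q - (J + 1) * (J + t + 1) * (p - 1) * (q - 1)\<close>. For \<open>p > 1\<close> the
  factors compare in pairs, both times by \<open>p \<le> J + 1\<close>; otherwise the subtracted
  product is not positive.\<close>

lemma crossing_form_diag_nonneg:
  assumes "J \<ge> 0" "t \<ge> 1" "0 \<le> p" "p \<le> J + 1"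
  shows "crossing_form J t p p \<ge> 0"
proof -
  define q where "q = p + t"
  have "(J + 1) * (J + t + 1) * ((p - 1) * (q - 1)) \<le> J * (J + t) * (p * q)"
  proof (cases "p \<le> 1")
    case True
    have "(1 - p) * (q - 1) \<ge> 0" using True assms by (simp add: q_def)
    then have "(J + 1) * (J + t + 1) * ((1 - p) * (q - 1)) \<ge> 0" using assms by simp
    moreover have "J * (J + t) * (p * q) \<ge> 0" using assms by (simp add: q_def)
    ultimately show ?thesis by (simp add: algebra_simps)
  next
    case False
    have "((J + 1) * (p - 1)) * ((J + t + 1) * (q - 1)) \<le> (J * p) * ((J + t) * q)"
    proof (rule mult_mono)
      show "(J + 1) * (p - 1) \<le> J * p" using assms by (simp add: algebra_simps)
      show "(J + t + 1) * (q - 1) \<le> (J + t) * q" using assms by (simp add: q_def algebra_simps)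
      show "0 \<le> J * p" using assms by simp
      show "0 \<le> (J + t + 1) * (q - 1)" using False assms by (simp add: q_def)
    qed
    then show ?thesis by (simp add: mult_ac)
  qed
  then have "0 \<le> 2 * (p * q) * (J * (J + t) * (p * q) - (J + 1) * (J + t + 1) * ((p - 1) * (q - 1)))"
    using assms by (intro mult_nonneg_nonneg) (auto simp: q_def)
  also have "\<dots> = crossing_form J t p p"
  proof -
    have "2 * (p * q) * (J * N * (p * q) - K * M * (u * v))
      = 2 * J * N * (p * q * (p * q)) - K * M * (p * u * (q * v) + p * u * (q * v))" for N K M u v
      by (simp add: algebra_simps)
    then show ?thesis unfolding crossing_form_def q_def .
  qed
  finally show ?thesis .
qed

text \<open>\<open>p' * r'\<close> lies between \<open>p * r\<close> and the square of half the sum,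
  and the concave quadratic is nonnegative at both ends.\<close>

lemma crossing_form_crossing:
  assumes "J \<ge> 0" "t \<ge> 1" "p + r = p' + r'" "p * r \<le> p' * r'" "p + r \<ge> 0" "p + r \<le> 2 * (J + 1)"
    and "crossing_form J t p r \<ge> 0"
  shows "crossing_form J t p' r' \<ge> 0"
proof -
  define S where "S = p + r"
  obtain b c where e: "\<And>p r. p + r = S \<Longrightarrow> crossing_form J t p r = (- 2 * (2 * J + t + 1)) * (p * r)\<^sup>2 + b * (p * r) + c"
    using crossing_form_quadratic [where J=J and t=t and S=S] by blast
  have "p' * r' \<le> S / 2 * (S / 2)"
    using zero_le_square [of "p' - r'"] assms(3) by (simp add: S_def algebra_simps)
  moreover have "crossing_form J t (S / 2) (S / 2) \<ge> 0"
    using assms by (intro crossing_form_diag_nonneg) (auto simp: S_def)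
  moreover have "crossing_form J t (S / 2) (S / 2) = (- 2 * (2 * J + t + 1)) * (S / 2 * (S / 2))\<^sup>2 + b * (S / 2 * (S / 2)) + c"
    by (rule e) simp
  moreover have S: "p + r = S" "p' + r' = S" using assms(3) by (auto simp: S_def)
  ultimately have "(- 2 * (2 * J + t + 1)) * (p' * r')\<^sup>2 + b * (p' * r') + c \<ge> 0"
    using assms(1,2,4,7) unfolding e [OF S(1)]
    by (intro quadratic_between_nonneg [of _ "p * r" "p' * r'" "S / 2 * (S / 2)"]) auto
  then show ?thesis unfolding e [OF S(2)] .
qed

text \<open>The \<open>T i k\<close> of the outline, symmetrised: its sum over
  \<open>i + k = n\<close> is twice the \<open>n\<close>-th coefficient of
  \<open>turan d j\<close>.\<close>

definition turan_sym :: "nat \<Rightarrow> nat \<Rightarrow> nat \<Rightarrow> nat \<Rightarrow> real" where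
  "turan_sym d j i k = 2 * (newton_coeff d j i * newton_coeff d j k) - newton_coeff d (j - 1) i * newton_coeff d (j + 1) k - newton_coeff d (j + 1) i * newton_coeff d (j - 1) k"

text \<open>Raising all arguments to \<open>j + 1\<close> and \<open>d - j + 1\<close> gives the
  three coefficients a common falling factorial part, at the cost of the linear factors
  \<open>P\<close> and \<open>Q\<close>.\<close>

lemma turan_sym_eq:
  assumes "0 < j" "j < d"
  shows "\<exists>C>0. turan_sym d j i k
     = C * (falling (real j + 1) i * falling (real d - real j + 1) i) * (falling (real j + 1) k * falling (real d - real j + 1) k)
       / (newton_weight d i * newton_weight d k)
       * crossing_form (real j) (real d - 2 * real j) (real j + 1 - real i) (real j + 1 - real k)"
proof -
  define J D where "J = real j" and "D = real d - real j"
  have pos: "J > 0" "D > 0" using assms by (auto simp: J_def D_def)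
  define L where "L i = falling (J + 1) i * falling (D + 1) i" for i
  have s: "x * falling (x - 1) i = falling x i * (x - real i)" for x i
    using falling_Suc_shift [of x i] by (simp add: falling_Suc)
  have s2: "(x + 1) * falling x i = falling (x + 1) i * (x + 1 - real i)" for x i
    using s [of "x + 1" i] by simp
  have s3: "(x + 1) * (x * falling (x - 1) i) = falling (x + 1) i * (x + 1 - real i) * (x - real i)" for x i
    using s [of x i] s2 [of x i] by algebra
  define P where "P i = J + 1 - real i" for i
  define Q where "Q i = D + 1 - real i" for i
  have c0: "(J + 1) * (D + 1) * newton_coeff d j i = L i * P i * Q i / newton_weight d i" for i
  proof -
    have "(J + 1) * (D + 1) * (falling J i * falling D i) = L i * P i * Q i"
      using s2 [of J i] s2 [of D i] unfolding L_def P_def Q_def by algebra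
    then show ?thesis by (simp add: newton_coeff_def J_def D_def)
  qed
  have c1: "D * (D + 1) * newton_coeff d (j + 1) i = L i * Q i * (Q i - 1) / newton_weight d i" for i
  proof -
    have "D * (D + 1) * (falling (J + 1) i * falling (D - 1) i) = L i * Q i * (Q i - 1)"
      using s3 [of D i] unfolding L_def P_def Q_def by algebra
    moreover have x: "real (j + 1) = J + 1" "real d - real (j + 1) = D - 1" by (auto simp: J_def D_def)
    ultimately show ?thesis unfolding newton_coeff_def x by (simp only: times_divide_eq_right)
  qed
  have c2: "J * (J + 1) * newton_coeff d (j - 1) i = L i * P i * (P i - 1) / newton_weight d i" for i
  proof -
    have "J * (J + 1) * (falling (J - 1) i * falling (D + 1) i) = L i * P i * (P i - 1)"
      using s3 [of J i] unfolding L_def P_def Q_def by algebra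
    moreover have x: "real (j - 1) = J - 1" "real d - real (j - 1) = D + 1" using assms by (auto simp: J_def D_def)
    ultimately show ?thesis unfolding newton_coeff_def x by (simp only: times_divide_eq_right)
  qed
  \<comment> \<open>To reach \<open>M\<close>, the multiplier of \<open>c0 * c0\<close> lacks
    \<open>J * D\<close> and that of \<open>c1 * c2\<close> lacks \<open>(J + 1) * (D + 1)\<close>;
    these become the coefficients in \<open>crossing_form\<close>.\<close>
  define M where "M = J * D * (J + 1)\<^sup>2 * (D + 1)\<^sup>2"
  define C where "C = 1 / M"
  have M: "M > 0" using pos by (simp add: M_def)
  then have "C > 0" by (simp add: C_def)
  moreover have "turan_sym d j i k = C * L i * L k / (newton_weight d i * newton_weight d k) * crossing_form J (D - J) (P i) (P k)"
  proof -
    have q: "P i + (D - J) = Q i" "P k + (D - J) = Q k" "J + (D - J) = D" by (auto simp: P_def Q_def)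
    have ring1: "(2 * (a * b) - u * y - x * v) * (J * D * J'\<^sup>2 * D'\<^sup>2)
      = 2 * J * D * ((J' * D' * a) * (J' * D' * b))
         - J' * D' * ((J * J' * u) * (D * D' * y) + (D * D' * x) * (J * J' * v))"
      for a b u v x y J D J' D' :: real
      by (simp add: algebra_simps power2_eq_square)
    have ring2: "2 * J * D * ((l * p * q * w) * (l' * p' * q' * w'))
        - J' * D' * ((l * p * r * w) * (l' * q' * s' * w') + (l * q * s * w) * (l' * p' * r' * w'))
      = l * l' * (w * w') * (2 * J * D * (p * q * (p' * q')) - J' * D' * (p * r * (q' * s') + p' * r' * (q * s)))"
      for J D J' D' l l' p p' q q' r r' s s' w w' :: real
      by (simp add: algebra_simps)
    have eq: "turan_sym d j i k * M = L i * L k / (newton_weight d i * newton_weight d k) * crossing_form J (D - J) (P i) (P k)"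
      unfolding turan_sym_def M_def ring1 c0 c1 c2 crossing_form_def q divide_inverse inverse_mult_distrib ring2 by simp
    have "turan_sym d j i k = turan_sym d j i k * M * C" using M by (simp add: C_def)
    also have "\<dots> = C * L i * L k / (newton_weight d i * newton_weight d k) * crossing_form J (D - J) (P i) (P k)"
      unfolding eq by simp
    finally show ?thesis .
  qed
  moreover have "D - J = real d - 2 * real j" by (simp add: D_def J_def)
  ultimately show ?thesis
    unfolding L_def P_def J_def D_def by (intro exI [of _ C]) simp
qed

text \<open>A larger minimum with the same sum means a larger \<open>i * k\<close>, hence a larger
  \<open>(j + 1 - i) * (j + 1 - k)\<close>, and \<open>crossing_form_crossing\<close>
  applies.\<close>

lemma turan_sym_crossing:
  assumes "0 < j" "2 * Suc j \<le> d" "i + k = i' + k'" "min i k \<le> min i' k'" "turan_sym d j i k > 0"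
  shows "turan_sym d j i' k' \<ge> 0"
proof -
  define J t where "J = real j" and "t = real d - 2 * real j"
  define L where "L i = falling (real j + 1) i * falling (real d - real j + 1) i" for i
  have eq: "real j + 1 = real (Suc j)" "real d - real j + 1 = real (d - j + 1)" using assms by auto
  have Lpos: "L i > 0" if "i \<le> Suc j" for i
    unfolding L_def eq using that assms by (intro mult_pos_pos falling_of_nat_pos) auto
  have L0: "L i = 0" if "i > Suc j" for i
    unfolding L_def using falling_of_nat_eq_0 [OF that] by (simp add: add.commute)
  have jd: "j < d" using assms by simp
  obtain C where C: "C > 0" "turan_sym d j i k = C * L i * L k / (newton_weight d i * newton_weight d k) * crossing_form J t (J + 1 - real i) (J + 1 - real k)"
    using turan_sym_eq [OF assms(1) jd, of i k] unfolding L_def J_def t_def by blast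
  obtain C' where C': "C' > 0" "turan_sym d j i' k' = C' * L i' * L k' / (newton_weight d i' * newton_weight d k') * crossing_form J t (J + 1 - real i') (J + 1 - real k')"
    using turan_sym_eq [OF assms(1) jd, of i' k'] unfolding L_def J_def t_def by blast
  \<comment> \<open>Strict positivity excludes indices above \<open>Suc j\<close>, where the falling
    factorials vanish.\<close>
  have "L i * L k \<noteq> 0"
  proof
    assume "L i * L k = 0"
    then have "turan_sym d j i k = 0" unfolding C(2) by auto
    with assms(5) show False by simp
  qed
  then have "\<not> Suc j < i" "\<not> Suc j < k" using L0 [of i] L0 [of k] by auto
  then have ik: "i \<le> Suc j" "k \<le> Suc j" by simp_all
  have ik': "i' \<le> Suc j" "k' \<le> Suc j" using ik assms(3,4) by linarith+
  have pos: "C * L i * L k / (newton_weight d i * newton_weight d k) > 0" "C' * L i' * L k' / (newton_weight d i' * newton_weight d k') > 0"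
    using C(1) C'(1) ik ik' assms(2) by (intro divide_pos_pos mult_pos_pos Lpos newton_weight_pos; simp)+
  have ph1: "crossing_form J t (J + 1 - real i) (J + 1 - real k) \<ge> 0"
    using zero_less_mult_pos [OF assms(5) [unfolded C(2)] pos(1)] by simp
  have prod: "real i * real k \<le> real i' * real k'"
  proof -
    have le: "x * y \<le> x' * y'" if xy: "x \<le> y" "x' \<le> y'" "x \<le> x'" "x + y = x' + y'" for x y x' y' :: nat
    proof -
      obtain u where u: "x' = x + u" using le_Suc_ex [OF xy(3)] by blast
      obtain v where v: "y' = x' + v" using le_Suc_ex [OF xy(2)] by blast
      have "y = x + 2 * u + v" using xy(4) u v by simp
      then show ?thesis unfolding u v by (simp add: algebra_simps)
    qed
    have "min i k + max i k = min i' k' + max i' k'"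
      using assms(3) by (simp add: min_def max_def)
    then have "min i k * max i k \<le> min i' k' * max i' k'"
      using assms(4) by (intro le) simp_all
    moreover have "min a b * max a b = a * b" for a b :: nat
      by (simp add: min_def max_def mult.commute)
    ultimately have "i * k \<le> i' * k'" by simp
    then show ?thesis by (metis of_nat_le_iff of_nat_mult)
  qed
  have sum: "real i + real k = real i' + real k'" using assms(3) by linarith
  have "(J + 1 - real i) * (J + 1 - real k) = (J + 1)\<^sup>2 - (J + 1) * (real i + real k) + real i * real k"
    by (simp add: algebra_simps power2_eq_square)
  also have "\<dots> \<le> (J + 1)\<^sup>2 - (J + 1) * (real i' + real k') + real i' * real k'" using prod sum by simp
  also have "\<dots> = (J + 1 - real i') * (J + 1 - real k')" by (simp add: algebra_simps power2_eq_square)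
  finally have "crossing_form J t (J + 1 - real i') (J + 1 - real k') \<ge> 0"
    using sum ik assms(2) by (intro crossing_form_crossing [OF _ _ _ _ _ _ ph1]) (auto simp: J_def t_def)
  then show ?thesis unfolding C'(2) by (rule mult_nonneg_nonneg [OF less_imp_le [OF pos(2)]])
qed

section \<open>Sums with one sign change and products of log-concave terms\<close>

text \<open>Let \<open>m\<close> have least \<open>h\<close> among the indices with \<open>T\<close>
  positive. Then \<open>x i\<close> is at least \<open>x m\<close> where \<open>T\<close> is
  positive and at most \<open>x m\<close> where it is negative, so
  \<open>T i * x i \<ge> x m * T i\<close> for every \<open>i\<close>.\<close>

lemma sum_mult_nonneg_single_crossing:
  fixes T x :: "'a \<Rightarrow> real" and h :: "'a \<Rightarrow> nat"
  assumes "finite A" "sum T A \<ge> 0"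
    and cross: "\<And>i k. i \<in> A \<Longrightarrow> k \<in> A \<Longrightarrow> T i > 0 \<Longrightarrow> h i \<le> h k \<Longrightarrow> T k \<ge> 0"
    and mono: "\<And>i k. i \<in> A \<Longrightarrow> k \<in> A \<Longrightarrow> h i \<le> h k \<Longrightarrow> x i \<le> x k"
    and nonneg: "\<And>i. i \<in> A \<Longrightarrow> x i \<ge> 0"
  shows "(\<Sum>i\<in>A. T i * x i) \<ge> 0"
proof (cases "\<exists>i\<in>A. T i > 0")
  case False
  then have np: "\<And>i. i \<in> A \<Longrightarrow> - T i \<ge> 0" by force
  then have "sum (\<lambda>i. - T i) A \<ge> 0" by (rule sum_nonneg)
  then have "sum (\<lambda>i. - T i) A = 0" using assms(2) by (simp add: sum_negf)
  then have "\<forall>i\<in>A. - T i = 0" using sum_nonneg_eq_0_iff [OF assms(1) np] by simp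
  then show ?thesis by simp
next
  case True
  then obtain i0 where "i0 \<in> A \<and> T i0 > 0" by blast
  from ex_has_least_nat [of "\<lambda>i. i \<in> A \<and> T i > 0", OF this, of h]
  obtain m where m: "m \<in> A" "T m > 0" "\<And>i. i \<in> A \<Longrightarrow> T i > 0 \<Longrightarrow> h m \<le> h i"
    by blast
  have "x m * T i \<le> T i * x i" if i: "i \<in> A" for i
  proof (cases "T i \<ge> 0")
    case nn: True
    show ?thesis
    proof (cases "T i = 0")
      case False
      then have "x m \<le> x i" using m i nn by (intro mono) auto
      then show ?thesis using nn by (simp add: mult.commute mult_left_mono)
    qed simp
  next
    case neg: False
    then have "\<not> h m \<le> h i" using cross [of m i] m i by auto
    then have "x i \<le> x m" using m i by (intro mono) auto
    then show ?thesis using neg by (simp add: mult.commute mult_left_mono_neg)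
  qed
  then have "x m * sum T A \<le> (\<Sum>i\<in>A. T i * x i)"
    unfolding sum_distrib_left by (intro sum_mono) auto
  moreover have "x m * sum T A \<ge> 0" using assms(2) m nonneg by simp
  ultimately show ?thesis by linarith
qed

lemma sum_turan_sym_nonneg:
  assumes "0 < j" "2 * Suc j \<le> d"
  shows "(\<Sum>i\<le>n. turan_sym d j i (n - i)) \<ge> 0"
proof -
  have rev: "(\<Sum>i\<le>n. newton_coeff d (j + 1) i * newton_coeff d (j - 1) (n - i)) = (\<Sum>i\<le>n. newton_coeff d (j - 1) i * newton_coeff d (j + 1) (n - i))"
    by (rule sum.reindex_bij_witness [of _ "\<lambda>i. n - i" "\<lambda>i. n - i"]) auto
  obtain k where "j = Suc k" using assms by (cases j) auto
  then have "0 \<le> coeff (turan d j) n" using coeff_turan_nonneg [of k d n] assms by simp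
  then have "0 \<le> 2 * coeff (turan d j) n" by simp
  also have "\<dots> = (\<Sum>i\<le>n. turan_sym d j i (n - i))"
    using rev by (simp add: turan_sym_def turan_def coeff_mult sum_subtractf sum_distrib_left [symmetric])
  finally show ?thesis .
qed

text \<open>Ratios of consecutive terms decrease. The inductive step multiplies by the inequality at
  \<open>b\<close> and cancels \<open>e b * e (Suc b)\<close>; for \<open>a < b\<close>, a zero
  there forces the left side to vanish.\<close>

lemma log_concave_mult_le:
  fixes e :: "nat \<Rightarrow> real"
  assumes nonneg: "\<And>i. e i \<ge> 0" and lc: "\<And>i. e i * e (i + 2) \<le> (e (i + 1))\<^sup>2"
    and niz: "\<And>i j k. i < j \<Longrightarrow> j < k \<Longrightarrow> e j = 0 \<Longrightarrow> e i * e k = 0"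
    and "a \<le> b"
  shows "e a * e (Suc b) \<le> e (Suc a) * e b"
  using \<open>a \<le> b\<close>
proof (induction b rule: dec_induct)
  case (step b)
  show ?case
  proof (cases "e (Suc b) = 0 \<or> (e b = 0 \<and> a < b)")
    case True
    then have "e a * e (Suc (Suc b)) = 0"
      using niz [of a "Suc b" "Suc (Suc b)"] niz [of a b "Suc (Suc b)"] step by auto
    then show ?thesis using nonneg by (metis mult_nonneg_nonneg)
  next
    case False
    show ?thesis
    proof (cases "a = b")
      case True
      then show ?thesis using lc [of a] by (simp add: power2_eq_square)
    next
      case ne: False
      then have pos: "e b * e (Suc b) > 0" using False step nonneg [of b] nonneg [of "Suc b"] by auto
      have "(e a * e (Suc b)) * (e b * e (Suc (Suc b))) \<le> (e (Suc a) * e b) * (e (Suc b))\<^sup>2"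
        using step.IH lc [of b] nonneg
        by (intro mult_mono [of "e a * e (Suc b)"]) auto
      then have "(e b * e (Suc b)) * (e a * e (Suc (Suc b))) \<le> (e b * e (Suc b)) * (e (Suc a) * e (Suc b))"
        by (simp add: power2_eq_square mult_ac)
      then show ?thesis using pos by (simp add: mult_le_cancel_left)
    qed
  qed
qed (simp add: mult.commute)

lemma log_concave_mult_mono:
  fixes e :: "nat \<Rightarrow> real"
  assumes "\<And>i. e i \<ge> 0" "\<And>i. e i * e (i + 2) \<le> (e (i + 1))\<^sup>2"
    and "\<And>i j k. i < j \<Longrightarrow> j < k \<Longrightarrow> e j = 0 \<Longrightarrow> e i * e k = 0"
    and "i \<le> n" "k \<le> n" "min i (n - i) \<le> min k (n - k)"
  shows "e i * e (n - i) \<le> e k * e (n - k)"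
proof -
  have "e i * e (n - i) \<le> e k * e (n - k)" if "i \<le> k" "2 * k \<le> n" for i k
    using that
  proof (induction k rule: dec_induct)
    case (step k)
    have "Suc (n - Suc k) = n - k" using step by simp
    then have "e k * e (n - k) \<le> e (Suc k) * e (n - Suc k)"
      using log_concave_mult_le [of e k "n - Suc k"] assms(1-3) step by simp
    then show ?case using step by simp
  qed simp
  from this [of "min i (n - i)" "min k (n - k)"]
  have "e (min i (n - i)) * e (n - min i (n - i)) \<le> e (min k (n - k)) * e (n - min k (n - k))"
    using assms(6) by simp
  moreover have "e (min i (n - i)) * e (n - min i (n - i)) = e i * e (n - i)" if "i \<le> n" for i
    using that by (cases "i \<le> n - i") (simp_all add: min_absorb1 min_absorb2 mult.commute)
  ultimately show ?thesis using assms(4,5) by simp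
qed

text \<open>A formal variable separates the terms by \<open>i + k\<close>: every coefficient of
  \<open>E j * E j - E (j - 1) * E (j + 1)\<close> is nonnegative, and evaluation at 1 gives the
  claim.\<close>

lemma log_concave_transform:
  fixes e :: "nat \<Rightarrow> real"
  assumes e: "\<And>i. e i \<ge> 0" "\<And>i. e i * e (i + 2) \<le> (e (i + 1))\<^sup>2"
     "\<And>i j k. i < j \<Longrightarrow> j < k \<Longrightarrow> e j = 0 \<Longrightarrow> e i * e k = 0"
    and j: "0 < j" "2 * Suc j \<le> d"
  shows "(\<Sum>i\<le>m. e i * newton_coeff d (j - 1) i) * (\<Sum>i\<le>m. e i * newton_coeff d (j + 1) i) \<le> (\<Sum>i\<le>m. e i * newton_coeff d j i)\<^sup>2"
proof -
  \<comment> \<open>Cutting off above \<open>m\<close> preserves log-concavity and creates no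
    internal zeros.\<close>
  define e' where "e' i = (if i \<le> m then e i else 0)" for i
  have e': "\<And>i. e' i \<ge> 0" "\<And>i. e' i * e' (i + 2) \<le> (e' (i + 1))\<^sup>2"
     "\<And>i j k. i < j \<Longrightarrow> j < k \<Longrightarrow> e' j = 0 \<Longrightarrow> e' i * e' k = 0"
  proof -
    show "e' i * e' (i + 2) \<le> (e' (i + 1))\<^sup>2" for i using e(2) [of i] by (simp add: e'_def)
    show "e' i * e' k = 0" if "i < j" "j < k" "e' j = 0" for i j k
      using e(3) [OF that(1,2)] that by (simp add: e'_def split: if_splits)
  qed (simp add: e'_def e(1))
  define E where "E j = (\<Sum>i\<le>m. monom (e i * newton_coeff d j i) i)" for j
  have cE: "coeff (E j) i = e' i * newton_coeff d j i" for i j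
    by (simp add: E_def coeff_sum e'_def)
  have pE: "poly (E j) 1 = (\<Sum>i\<le>m. e i * newton_coeff d j i)" for j
    by (simp add: E_def poly_sum poly_monom)
  have "coeff (E j * E j - E (j - 1) * E (j + 1)) n \<ge> 0" for n
  proof -
    have rev: "(\<Sum>i\<le>n. e' i * newton_coeff d (j + 1) i * (e' (n - i) * newton_coeff d (j - 1) (n - i)))
      = (\<Sum>i\<le>n. e' i * newton_coeff d (j - 1) i * (e' (n - i) * newton_coeff d (j + 1) (n - i)))"
      by (rule sum.reindex_bij_witness [of _ "\<lambda>i. n - i" "\<lambda>i. n - i"]) auto
    have "0 \<le> (\<Sum>i\<le>n. turan_sym d j i (n - i) * (e' i * e' (n - i)))"
    proof (rule sum_mult_nonneg_single_crossing [where h = "\<lambda>i. min i (n - i)"])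
      show "0 \<le> (\<Sum>i\<le>n. turan_sym d j i (n - i))" by (rule sum_turan_sym_nonneg [OF j])
      show "0 \<le> turan_sym d j k (n - k)"
        if "i \<in> {..n}" "k \<in> {..n}" "0 < turan_sym d j i (n - i)" "min i (n - i) \<le> min k (n - k)" for i k
        using that by (intro turan_sym_crossing [OF j, of i "n - i"]) auto
      show "e' i * e' (n - i) \<le> e' k * e' (n - k)"
        if "i \<in> {..n}" "k \<in> {..n}" "min i (n - i) \<le> min k (n - k)" for i k
        using that by (intro log_concave_mult_mono e') auto
    qed (auto intro!: mult_nonneg_nonneg e')
    also have "\<dots> = (\<Sum>i\<le>n. 2 * (e' i * newton_coeff d j i * (e' (n - i) * newton_coeff d j (n - i)))
         - e' i * newton_coeff d (j - 1) i * (e' (n - i) * newton_coeff d (j + 1) (n - i))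
         - e' i * newton_coeff d (j + 1) i * (e' (n - i) * newton_coeff d (j - 1) (n - i)))"
      by (intro sum.cong refl) (simp add: turan_sym_def algebra_simps)
    also have "\<dots> = 2 * coeff (E j * E j - E (j - 1) * E (j + 1)) n"
      using rev by (simp only: coeff_diff coeff_mult cE sum_subtractf sum_distrib_left [symmetric])
         (simp add: algebra_simps)
    finally show ?thesis by simp
  qed
  then have "poly (E j * E j - E (j - 1) * E (j + 1)) 1 \<ge> 0"
    unfolding poly_altdef by (auto intro!: sum_nonneg)
  then show ?thesis by (simp add: pE power2_eq_square)
qed

section \<open>Normalised coefficients of the gamma basis\<close>

text \<open>The left side is the normalised coefficient of \<open>x ^ j\<close> in
  \<open>x ^ i * (1 + x) ^ (d - 2 * i)\<close>; written in factorials, its dependence on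
  \<open>j\<close> separates.\<close>

lemma choose_ratio_eq_falling:
  assumes "j \<le> d" "i \<le> j" "i \<le> d - j"
  shows "real (d - 2 * i choose (j - i)) / real (d choose j)
     = falling (real j) i * falling (real d - real j) i / falling (real d) (2 * i)"
proof -
  have 1: "real d - real j = real (d - j)" using assms by simp
  have 2: "d - 2 * i - (j - i) = d - j - i" using assms by simp
  have "real (d - 2 * i choose (j - i)) = fact (d - 2 * i) / (fact (j - i) * fact (d - j - i))"
    using binomial_fact [of "j - i" "d - 2 * i", where 'a = real] assms 2 by simp
  moreover have "real (d choose j) = fact d / (fact j * fact (d - j))"
    using binomial_fact [of j d, where 'a = real] assms by simp
  moreover have "falling (real j) i = fact j / fact (j - i)" "falling (real (d - j)) i = fact (d - j) / fact (d - j - i)"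
    "falling (real d) (2 * i) = fact d / fact (d - 2 * i)"
    using assms by (intro falling_of_nat_fact; simp)+
  ultimately show ?thesis unfolding 1 by simp
qed

text \<open>The even offsets go into \<open>rescale\<close>, the odd ones into
  \<open>newton_weight\<close>.\<close>

lemma falling_double: "falling (real d) (2 * i) = (\<Prod>l<i. real d - 2 * real l) * (\<Prod>l<i. real d - 1 - 2 * real l)"
  by (induction i) (simp_all add: falling_Suc algebra_simps)

lemma coeff_gamma_poly: "coeff (gamma_poly d \<gamma>) i = (if i \<le> d div 2 then \<gamma> i else 0)"
  by (simp add: gamma_poly_def coeff_sum monom_altdef [symmetric])

lemma coeff_gamma_expansion:
  "coeff (gamma_expansion d \<gamma>) j
     = (\<Sum>i\<le>d div 2. \<gamma> i * (if i \<le> j then real (d - 2 * i choose (j - i)) else 0))"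
proof -
  have p: "coeff ([:1, 1:] ^ n) k = real (n choose k)" for n k
  proof (cases "k \<le> n")
    case False
    moreover have "degree ([:1, 1::real:] ^ n) \<le> n"
      using degree_power_le [of "[:1, 1::real:]" n] by simp
    ultimately show ?thesis by (simp add: coeff_eq_0)
  qed (simp add: coeff_linear_poly_power)
  have "coeff ([:0, 1:] ^ i * [:1, 1:] ^ n) j = (if i \<le> j then real (n choose (j - i)) else 0)" for i n
    using coeff_monom_mult [of "1::real" i "[:1, 1:] ^ n" j] by (simp add: monom_altdef p)
  then show ?thesis by (simp add: gamma_expansion_def coeff_sum del: mult_pCons_left mult_pCons_right)
qed

text \<open>
  For even \<open>d\<close> this is \<open>(1 / 2) ^ i\<close>. For odd \<open>d\<close> it is still log-concave, which reduces both parities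
  to the same weights.
\<close>

definition rescale :: "nat \<Rightarrow> nat \<Rightarrow> real" where
  "rescale d i = (\<Prod>l<i. (real (d div 2) - real l) / (real d - 2 * real l))"

lemma rescale_pos: "i \<le> d div 2 \<Longrightarrow> rescale d i > 0"
  unfolding rescale_def by (intro prod_pos) (auto intro!: divide_pos_pos)

text \<open>The successive ratios \<open>(m - l) / (d - 2 * l)\<close> do not increase, because
  \<open>2 * m \<le> d\<close>.\<close>

lemma rescale_log_concave:
  assumes "i + 2 \<le> d div 2"
  shows "rescale d i * rescale d (i + 2) \<le> (rescale d (i + 1))\<^sup>2"
proof -
  define \<rho> where "\<rho> l = (real (d div 2) - real l) / (real d - 2 * real l)" for l
  define m where "m = real (d div 2)"
  have m: "2 * m \<le> real d" "real i + 2 \<le> m" using assms by (auto simp: m_def)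
  have le: "\<rho> (i + 1) \<le> \<rho> i"
    using m unfolding \<rho>_def m_def [symmetric] by (simp add: divide_simps) (simp add: algebra_simps)
  have nn: "\<rho> i \<ge> 0"
    using m unfolding \<rho>_def m_def [symmetric] by (intro divide_nonneg_nonneg) auto
  have s: "rescale d (Suc i) = rescale d i * \<rho> i" for i by (simp add: rescale_def \<rho>_def)
  have "rescale d i * rescale d (i + 2) = (rescale d i)\<^sup>2 * \<rho> i * \<rho> (i + 1)"
    using s [of i] s [of "Suc i"] by (simp add: power2_eq_square)
  also have "\<dots> \<le> (rescale d i)\<^sup>2 * \<rho> i * \<rho> i"
    using le nn by (intro mult_left_mono) auto
  also have "\<dots> = (rescale d (i + 1))\<^sup>2" using s [of i] by (simp add: power2_eq_square)
  finally show ?thesis .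
qed

text \<open>The numerators in \<open>rescale\<close> multiply to \<open>i!\<close> times
  \<open>d div 2 choose i\<close>. The factorial cancels against \<open>newton_weight\<close>; the
  binomial is the normalisation in \<open>ULC (d div 2)\<close>.\<close>

lemma rescale_mult_newton_coeff:
  assumes "i \<le> d div 2" "2 * j \<le> d"
  shows "rescale d i * newton_coeff d j i * real (d choose j)
     = real (d div 2 choose i) * (if i \<le> j then real (d - 2 * i choose (j - i)) else 0)"
proof (cases "i \<le> j")
  case True
  have 0: "real (d choose j) \<noteq> 0" using assms by simp
  have A: "(\<Prod>l<i. real (d div 2) - real l) = real (d div 2 choose i) * fact i"
    using falling_of_nat_fact [of i "d div 2"] binomial_fact [of i "d div 2", where 'a = real] assms
    by (simp add: falling_def)
  have "rescale d i * newton_coeff d j i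
     = real (d div 2 choose i) * (falling (real j) i * falling (real d - real j) i / falling (real d) (2 * i))"
    unfolding rescale_def newton_coeff_def newton_weight_def prod_dividef A falling_double by simp
  also have "\<dots> = real (d div 2 choose i) * (real (d - 2 * i choose (j - i)) / real (d choose j))"
    using choose_ratio_eq_falling [of j d i] assms True by simp
  finally show ?thesis using True 0 by simp
qed (simp add: newton_coeff_eq_0)

section \<open>Symmetry, unimodality and log-concavity of the normalised coefficients\<close>

theorem theorem3p3:
  fixes f :: "real poly" and d :: nat and \<gamma> :: "nat \<Rightarrow> real"
  assumes "symmetric_poly d f"
    and "f = gamma_expansion d \<gamma>"
    and "gamma_poly d \<gamma> \<in> ULC (d div 2)"
  shows "f \<in> ULC d"
proof -
  define m where "m = d div 2"
  define c where "c i = coeff (gamma_poly d \<gamma>) i / real (m choose i)" for i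
  define e where "e i = c i * rescale d i" for i
  have c0: "c i = 0" if "i > m" for i using that by (simp add: c_def coeff_gamma_poly m_def)
  have c_nn: "c i \<ge> 0" for i using assms(3) by (simp add: c_def ULC_def)
  have c_lc: "c i * c (i + 2) \<le> (c (i + 1))\<^sup>2" for i
  \<comment> \<open>The hypothesis speaks only of indices \<open>i + 1\<close> below the degree;
    otherwise \<open>c (i + 2) = 0\<close>.\<close>
  proof (cases "i + 1 < degree (gamma_poly d \<gamma>)")
    case True
    have "log_concave_upto (degree (gamma_poly d \<gamma>)) c"
      using assms(3) by (simp add: ULC_def c_def [abs_def] m_def)
    then show ?thesis using True unfolding log_concave_upto_def by (auto dest: spec [of _ "i + 1"])
  next
    case False
    then have "c (i + 2) = 0" by (simp add: c_def coeff_eq_0)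
    then show ?thesis by simp
  qed
  have e_nn: "e i \<ge> 0" for i
    using c_nn [of i] rescale_pos [of i d] c0 [of i] by (cases "i \<le> m") (auto simp: e_def m_def)
  have e_lc: "e i * e (i + 2) \<le> (e (i + 1))\<^sup>2" for i
  proof (cases "i + 2 \<le> m")
    case True
    have "(c i * c (i + 2)) * (rescale d i * rescale d (i + 2)) \<le> (c (i + 1))\<^sup>2 * (rescale d (i + 1))\<^sup>2"
      using True rescale_pos [of i d] rescale_pos [of "i + 2" d]
      by (intro mult_mono c_lc rescale_log_concave mult_nonneg_nonneg) (auto simp: m_def)
    then show ?thesis by (simp add: e_def power_mult_distrib mult_ac)
  qed (simp add: e_def c0)
  have e_0: "e i = 0 \<longleftrightarrow> coeff (gamma_poly d \<gamma>) i = 0" for i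
    using rescale_pos [of i d] by (cases "i \<le> m") (auto simp: e_def c_def m_def coeff_gamma_poly)
  have e_niz: "e i * e k = 0" if "i < j" "j < k" "e j = 0" for i j k
    using assms(3) that e_0 unfolding ULC_def no_internal_zeros_def by (auto simp: mult_eq_0_iff)
  define F where "F j = coeff f j / real (d choose j)" for j
  have F: "F j = (\<Sum>i\<le>m. e i * newton_coeff d j i)" if "2 * j \<le> d" for j
  proof -
    have "(\<Sum>i\<le>m. e i * newton_coeff d j i) * real (d choose j) = coeff f j"
      unfolding assms(2) coeff_gamma_expansion sum_distrib_right m_def [symmetric]
    proof (rule sum.cong)
      fix i assume i: "i \<in> {..m}"
      have "e i * newton_coeff d j i * real (d choose j) = c i * (rescale d i * newton_coeff d j i * real (d choose j))"
        by (simp add: e_def)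
      also have "\<dots> = c i * real (m choose i) * (if i \<le> j then real (d - 2 * i choose (j - i)) else 0)"
        using rescale_mult_newton_coeff [of i d j] i that by (simp add: m_def)
      also have "c i * real (m choose i) = \<gamma> i" using i by (simp add: c_def coeff_gamma_poly m_def)
      finally show "e i * newton_coeff d j i * real (d choose j)
        = \<gamma> i * (if i \<le> j then real (d - 2 * i choose (j - i)) else 0)" .
    qed simp
    moreover have "real (d choose j) > 0" using that by simp
    ultimately show ?thesis by (simp add: F_def field_simps)
  qed
  have F_sym: "F (d - j) = F j" if "j \<le> d" for j
    using that symmetric_poly_coeff [OF assms(1)] by (simp add: F_def binomial_symmetric [symmetric])
  have F_nn_half: "F j \<ge> 0" if "2 * j \<le> d" for j
    using that by (auto simp: F intro!: sum_nonneg mult_nonneg_nonneg e_nn newton_coeff_nonneg)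
  have F_mono: "F j \<le> F k" if "2 * k \<le> d" "j \<le> k" for j k
    using that by (auto simp: F intro!: sum_mono mult_left_mono newton_coeff_mono_le e_nn)
  have F_nn: "F j \<ge> 0" for j
  proof -
    consider "2 * j \<le> d" | "2 * (d - j) \<le> d" "j \<le> d" | "j > d" by linarith
    then show ?thesis
    proof cases
      case 2 then show ?thesis using F_nn_half [of "d - j"] F_sym [of j] by simp
    next
      case 3 then show ?thesis by (simp add: F_def binomial_eq_0)
    qed (rule F_nn_half)
  qed
  have lc_half: "F (j - 1) * F (j + 1) \<le> (F j)\<^sup>2" if j: "0 < j" "2 * j \<le> d" for j
  proof (cases "2 * Suc j \<le> d")
    case True
    then show ?thesis
      using log_concave_transform [OF e_nn e_lc e_niz j(1) True, where m = m] j by (simp add: F)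
  next
    case False
    \<comment> \<open>Here \<open>j = d div 2\<close>, so \<open>j + 1\<close> reflects into the
      lower half and \<open>F j\<close> is the largest of the three values.\<close>
    have "F (j + 1) \<le> F j"
    proof (cases "j < d")
      case True
      then have "F (j + 1) = F (d - (j + 1))" using F_sym [of "j + 1"] by simp
      also have "\<dots> \<le> F j" using j False by (intro F_mono) auto
      finally show ?thesis .
    qed (use j in simp)
    moreover have "F (j - 1) \<le> F j" using j by (intro F_mono) auto
    ultimately show ?thesis unfolding power2_eq_square by (intro mult_mono F_nn)
  qed
  have lc: "F (j - 1) * F (j + 1) \<le> (F j)\<^sup>2" if j: "0 < j" "j < d" for j
  proof (cases "2 * j \<le> d")
    case False
    \<comment> \<open>Reflecting \<open>j\<close> to \<open>d - j\<close> swaps the two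
      neighbours.\<close>
    have "F (d - j - 1) * F (d - j + 1) \<le> (F (d - j))\<^sup>2" using j False by (intro lc_half) auto
    moreover have "d - j - 1 = d - (j + 1)" "d - j + 1 = d - (j - 1)" using j by auto
    moreover have "F (d - (j + 1)) = F (j + 1)" "F (d - (j - 1)) = F (j - 1)" "F (d - j) = F j"
      using j by (intro F_sym; simp)+
    ultimately show ?thesis by (simp add: mult.commute)
  qed (use lc_half j in auto)
  have deg: "degree f \<le> d" using assms(1) by (simp add: symmetric_poly_def)
  have F_0: "coeff f j = 0 \<longleftrightarrow> F j = 0" for j
    using deg by (cases "j \<le> d") (auto simp: F_def coeff_eq_0)
  have "no_internal_zeros f"
    unfolding no_internal_zeros_def
  proof (intro notI, elim exE conjE)
    fix i j k assume ijk: "i < j" "j < k" "coeff f j = 0" "coeff f i * coeff f k \<noteq> 0"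
    have k: "k \<le> d" using ijk deg by (metis le_degree le_trans mult_zero_right)
    show False
    proof (cases "2 * j \<le> d")
      case True
      \<comment> \<open>\<open>F\<close> increases up to the middle, so a zero at \<open>j\<close>
        forces one at \<open>i\<close>; in the upper half, reflection does the same for
        \<open>k\<close>.\<close>
      then have "F i \<le> F j" using ijk by (intro F_mono) auto
      then show False using ijk F_0 F_nn [of i] by auto
    next
      case False
      then have "F (d - k) \<le> F (d - j)" using ijk k by (intro F_mono) auto
      then show False using ijk k F_0 F_nn [of k] F_sym [of k] F_sym [of j] by auto
    qed
  qed
  moreover have "coeff f j \<ge> 0" for j
    using F_nn [of j] F_0 [of j] by (cases "j \<le> d") (auto simp: F_def zero_le_divide_iff)
  moreover have "log_concave_upto (degree f) (\<lambda>j. coeff f j / real (d choose j))"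
    using lc deg by (simp add: log_concave_upto_def F_def)
  ultimately show ?thesis using deg by (simp add: ULC_def)
qed

end
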